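(* Let $c > 0$ be real, and for real $s > 0$ let $P_{s,2,c} = \{(x,y) : x \in [0,s],\ y \in \{c, 2c\}\} \subseteq \mathbb{R}^2$. For all $s > 0$, $\operatorname{opx}(n, P_{s,2,c}) = \Theta(s^{\frac12} n^{\frac32})$ as $n \to \infty$, where the implied multiplicative constants depend only on $c$.
   Context: Containment for subsets of the plane: for $P, S \subseteq \mathbb{R}^2$, let $X_P, Y_P$ be the sets of $x$-coordinates and $y$-coordinates of points of $P$, and $X_S, Y_S$ likewise for $S$. $S$ contains $P$ if there exist functions $f_X: X_P \to X_S$ and $f_Y: Y_P \to Y_S$ such that (1) $\frac{f_X(x_0)-f_X(x_1)}{x_0-x_1} \ge 1$ for all $x_0 > x_1$ in $X_P$; (2) $\frac{f_Y(y_0)-f_Y(y_1)}{y_0-y_1} \ge 1$ for all $y_0 > y_1$ in $Y_P$; (3) $(f_X(x), f_Y(y)) \in S$ for all $(x,y) \in P$. Otherwise $S$ is $P$-free. For real $n > 0$, $\operatorname{opx}(n,P)$ is the supremum of the Lebesgue measure $\mu_2(S)$ over all open (in $\mathbb{R}^2$) $P$-free subsets $S \subseteq [0,n]^2$. $f(n) = \Theta(g(n))$ means there are constants $C_1, C_2 > 0$ with $C_1 g(n) \le f(n) \le C_2 g(n)$ for all sufficiently large $n$. Here $n$ ranges over positive reals, $C_1, C_2$ depend only on $c$, and the threshold for "sufficiently large" may depend on $s$ and $c$. *)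

theory Defs
  imports "HOL-Analysis.Analysis"
begin

text \<open>Maps with domain \<open>X\<close> are total functions restricted by \<open>f \<in> X \<rightarrow> Y\<close>; their values
  outside \<open>X\<close> play no role.\<close>

definition expanding_on :: "real set \<Rightarrow> (real \<Rightarrow> real) \<Rightarrow> bool" where
  "expanding_on X f \<longleftrightarrow>
     (\<forall>u\<in>X. \<forall>v\<in>X. u > v \<longrightarrow> (f u - f v) / (u - v) \<ge> 1)"

definition contains_pattern :: "(real \<times> real) set \<Rightarrow> (real \<times> real) set \<Rightarrow> bool" where
  "contains_pattern S P \<longleftrightarrow>
     (\<exists>fX fY. fX \<in> fst ` P \<rightarrow> fst ` S \<and> fY \<in> snd ` P \<rightarrow> snd ` S \<and>
        expanding_on (fst ` P) fX \<and> expanding_on (snd ` P) fY \<and>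
        (\<forall>(x, y)\<in>P. (fX x, fY y) \<in> S))"

abbreviation pattern_free :: "(real \<times> real) set \<Rightarrow> (real \<times> real) set \<Rightarrow> bool" where
  "pattern_free P S \<equiv> \<not> contains_pattern S P"

text \<open>For \<open>P \<noteq> {}\<close> and \<open>n \<ge> 0\<close> the supremum is over a nonempty set (\<open>S = {}\<close> is allowed)
  that is bounded above by \<open>n\<^sup>2\<close>, so it is a genuine least upper bound in the reals.\<close>

definition opx :: "real \<Rightarrow> (real \<times> real) set \<Rightarrow> real" where
  "opx n P = Sup {measure lebesgue S | S.
     open S \<and> S \<subseteq> {0..n} \<times> {0..n} \<and> pattern_free P S}"

definition two_segments :: "real \<Rightarrow> real \<Rightarrow> (real \<times> real) set" where
  "two_segments s c = {(x, y). x \<in> {0..s} \<and> y \<in> {c, 2 * c}}"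

end

theory Submission
  imports Defs "HOL-Library.Z2" "HOL-Algebra.Algebraic_Closure_Type"
begin

text \<open>
  An open set \<open>S\<close> contains the pattern as soon as two horizontal slices at distance at least \<open>c\<close>
  meet in measure more than \<open>s\<close>, because the generalised inverse of \<open>x \<mapsto> |K \<inter> (-\<infinity>, x]|\<close>, for a
  closed subset \<open>K\<close> of the intersection, is an expanding map into it.  So a pattern-free \<open>S\<close> is a
  continuous analogue of a graph without a large complete bipartite subgraph on two rows, and the
  Kovari-Sos-Turan argument (Cauchy-Schwarz over the vertical lines) gives the upper bound.

  For the lower bound, cut the square into cells of width \<open>s/2\<close> and height \<open>c\<close>.  With
  \<open>q = 2\<^sup>k\<close> and \<open>q\<^sup>2 \<approx> n/s\<close> up to constants, index the columns by the affine plane over the field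
  with \<open>q\<close> elements and let each row select the graph of a quadratic polynomial over it.  Two rows
  share at most two columns, so by pigeonhole two of \<open>f 0, f (s/2), f s\<close> would fall into the same
  column, which is too narrow.  Lines would give the same measure, but only \<open>q\<^sup>2\<close> rows, which may
  be fewer than the \<open>n/c\<close> rows available; there are \<open>q\<^sup>3\<close> quadratics.
\<close>

section \<open>Expanding maps into sets of large measure\<close>

text \<open>The function \<open>F\<close>, measuring the part of \<open>K\<close> to the left of a
  point, is nondecreasing and 1-Lipschitz, so any right inverse of it is expanding. Closedness of
  \<open>K\<close> lets the right inverse take its values in \<open>K\<close>.\<close>

lemma expanding_map_into_closed:
  fixes K :: "real set"
  assumes "closed K" "bounded K" "0 < s" "s < measure lborel K"
  obtains f where "f \<in> {0..s} \<rightarrow> K" "expanding_on {0..s} f"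
proof -
  define F where "F x = measure lborel (K \<inter> {..x})" for x
  have K[measurable]: "K \<in> sets borel"
    using assms by simp
  have fin: "A \<in> fmeasurable lborel" if "A \<subseteq> K" "A \<in> sets borel" for A
    using that bounded_subset[OF assms(2)] by (intro fmeasurableI emeasure_bounded_finite) auto
  obtain b where b: "\<And>x. x \<in> K \<Longrightarrow> \<bar>x\<bar> \<le> b"
    using assms(2) by (auto simp: bounded_iff)
  have F_diff: "0 \<le> F y - F x \<and> F y - F x \<le> y - x" if "x \<le> y" for x y
  proof -
    have "K \<inter> {..y} = (K \<inter> {..x}) \<union> (K \<inter> {x<..y})"
      using that by auto
    then have "F y = F x + measure lborel (K \<inter> {x<..y})"
      unfolding F_def by (simp, subst measure_Un2) (auto intro!: fin arg_cong[where f = "measure lborel"])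
    moreover have "measure lborel (K \<inter> {x<..y}) \<le> measure lborel {x<..y}"
      by (intro measure_mono_fmeasurable) (auto intro!: fmeasurableI emeasure_bounded_finite bounded_subset[OF bounded_closed_interval, of _ x y])
    ultimately show ?thesis
      using that by simp
  qed
  have "1-lipschitz_on UNIV F"
  proof (rule lipschitz_onI)
    fix x y show "dist (F x) (F y) \<le> 1 * dist x y"
      using F_diff[of x y] F_diff[of y x] by (cases "x \<le> y") (auto simp: dist_real_def)
  qed simp
  then have cont: "continuous_on UNIV F"
    by (rule lipschitz_on_continuous_on)
  have "K \<inter> {..b} = K" "K \<inter> {..-b-1} = {}"
    using b by force+
  then have F_ends: "F b = measure lborel K" "F (-b-1) = 0"
    by (simp_all add: F_def)
  \<comment> \<open>The intermediate value theorem gives a point \<open>z\<close> that may lie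
    outside \<open>K\<close>. Moving left to the last point of \<open>K\<close> up to
    \<open>z\<close> does not change \<open>F\<close>. That point exists because
    \<open>t > 0\<close> makes \<open>K \<inter> {..z}\<close> nonempty.\<close>
  have hit: "\<exists>x\<in>K. F x = t" if t: "0 < t" "t \<le> measure lborel K" for t
  proof -
    have "-b-1 \<le> b"
      using F_diff[of b "-b-1"] F_ends t by linarith
    then obtain z where z: "F z = t"
      using IVT'[of F "-b-1" t b] F_ends t cont continuous_on_subset by (metis less_imp_le subset_UNIV)
    let ?L = "K \<inter> {..z}"
    have "?L \<noteq> {}"
      using z t by (auto simp: F_def)
    moreover have "closed ?L" "bdd_above ?L"
      using assms(1) by (auto intro: closed_Int)
    ultimately have sup: "Sup ?L \<in> ?L"
      by (intro closed_contains_Sup)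
    moreover have "K \<inter> {..Sup ?L} = ?L"
      using sup cSup_upper[OF _ \<open>bdd_above ?L\<close>] by force
    ultimately show ?thesis
      using z unfolding F_def by (intro bexI[of _ "Sup ?L"]) auto
  qed
  \<comment> \<open>The shift by the excess \<open>e > 0\<close> carries \<open>{0..s}\<close> to
    levels between \<open>e\<close> and the measure of \<open>K\<close>, which avoids level 0, where
    \<open>hit\<close> says nothing.\<close>
  define e where "e = measure lborel K - s"
  have "\<forall>t\<in>{0..s}. \<exists>x\<in>K. F x = t + e"
    using hit assms(4) by (auto simp: e_def)
  then obtain f where f: "\<And>t. t \<in> {0..s} \<Longrightarrow> f t \<in> K \<and> F (f t) = t + e"
    by metis
  show ?thesis
  proof
    show "f \<in> {0..s} \<rightarrow> K"
      using f by auto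
    show "expanding_on {0..s} f"
      unfolding expanding_on_def
    proof (intro ballI impI)
      fix u v assume uv: "u \<in> {0..s}" "v \<in> {0..s}" "v < u"
      then have *: "F (f u) - F (f v) = u - v"
        using f by simp
      then have "u - v \<le> f u - f v"
        using F_diff[of "f v" "f u"] F_diff[of "f u" "f v"] uv by linarith
      then show "1 \<le> (f u - f v) / (u - v)"
        using uv by simp
    qed
  qed
qed

text \<open>By inner regularity, a closed subset can be chosen that loses less measure than the
  excess over \<open>s\<close>.\<close>

lemma expanding_map_into_open:
  fixes A :: "real set"
  assumes "open A" "bounded A" "0 < s" "s < measure lborel A"
  obtains f where "f \<in> {0..s} \<rightarrow> A" "expanding_on {0..s} f"
proof -
  have A: "A \<in> sets borel"
    using assms by simp
  obtain K where K: "closed K" "K \<subseteq> A" "A - K \<in> lmeasurable"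
      "emeasure lebesgue (A - K) < ennreal (measure lborel A - s)"
    using sets_lebesgue_inner_closed[of A "measure lborel A - s"] A assms by auto
  have bK: "bounded K"
    using K assms bounded_subset by blast
  have "measure lborel A = measure lborel K + measure lborel (A - K)"
    using K assms bK
    by (subst measure_Un2[symmetric]) (auto intro!: fmeasurableI emeasure_bounded_finite arg_cong[where f = "measure lborel"] intro: bounded_subset)
  moreover have "measure lborel (A - K) < measure lborel A - s"
    using K assms by (simp add: emeasure_eq_measure2 ennreal_less_iff)
  ultimately have "s < measure lborel K"
    by linarith
  with K(1) bK assms(3) obtain f where "f \<in> {0..s} \<rightarrow> K" "expanding_on {0..s} f"
    using expanding_map_into_closed by blast
  with K(2) show ?thesis
    by (intro that[of f]) auto
qed

section \<open>Upper bound from common slices\<close>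

lemma fst_two_segments: "s \<ge> 0 \<Longrightarrow> fst ` two_segments s c = {0..s}"
  by (force simp: two_segments_def)

lemma snd_two_segments: "s \<ge> 0 \<Longrightarrow> snd ` two_segments s c = {c, 2 * c}"
  by (force simp: two_segments_def)

text \<open>An expanding map into the common slice places both segments horizontally, and sending
  \<open>c\<close> to \<open>y\<close> and \<open>2 * c\<close> to \<open>y'\<close> is expanding
  because the heights differ by at least \<open>c\<close>.\<close>

lemma pattern_free_slices:
  assumes "open S" "bounded S" "pattern_free (two_segments s c) S" "0 < s" "0 < c" "y + c \<le> y'"
  shows "measure lborel {x. (x, y) \<in> S \<and> (x, y') \<in> S} \<le> s"
proof (rule ccontr)
  define A where "A = {x. (x, y) \<in> S \<and> (x, y') \<in> S}"
  assume "\<not> ?thesis"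
  then have large: "s < measure lborel A"
    by (simp add: A_def)
  have "A = (\<lambda>x. (x, y)) -` S \<inter> (\<lambda>x. (x, y')) -` S"
    by (auto simp: A_def)
  then have "open A"
    using assms(1) by (auto intro!: open_Int open_vimage continuous_intros)
  moreover have "bounded A"
    using bounded_fst[OF assms(2)] by (rule bounded_subset) (force simp: A_def)
  ultimately obtain f where f: "f \<in> {0..s} \<rightarrow> A" "expanding_on {0..s} f"
    using expanding_map_into_open[of A s] large assms(4) by blast
  define h where "h v = (if v = c then y else y')" for v
  have in_S: "(f u, h v) \<in> S" if "u \<in> {0..s}" for u v
    using f(1) that by (auto simp: A_def h_def)
  have "contains_pattern S (two_segments s c)"
    unfolding contains_pattern_def
  proof (intro exI conjI)
    have "f u \<in> fst ` S" if "u \<in> {0..s}" for u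
      using in_S[OF that, of c] by force
    then show "f \<in> fst ` two_segments s c \<rightarrow> fst ` S"
      using assms(4) by (simp add: fst_two_segments)
    have "h v \<in> snd ` S" for v
      using in_S[of 0 v] assms(4) by force
    then show "h \<in> snd ` two_segments s c \<rightarrow> snd ` S"
      by simp
    show "expanding_on (fst ` two_segments s c) f"
      using f assms(4) by (simp add: fst_two_segments)
    show "expanding_on (snd ` two_segments s c) h"
      using assms by (auto simp: snd_two_segments expanding_on_def h_def)
    show "\<forall>(u, v)\<in>two_segments s c. (f u, h v) \<in> S"
      using in_S by (auto simp: two_segments_def)
  qed
  with assms(3) show False by simp
qed

text \<open>Cauchy-Schwarz against the indicator of \<open>{0..n}\<close> bounds the squared measure
  by \<open>n\<close> times the integral of the squared lengths of the vertical slices. By Tonelli,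
  that integral is the measure of the common slice integrated over all pairs of heights. Pairs at
  distance at least \<open>c\<close> contribute at most \<open>s * n\<^sup>2\<close>; the closer
  pairs contribute at most \<open>2 * c\<close> times the measure of \<open>S\<close>.\<close>

lemma measure_le_of_slices:
  fixes S :: "(real \<times> real) set"
  assumes "open S" "S \<subseteq> {0..n} \<times> {0..n}" "0 < c" "0 < s" "0 \<le> n"
    and slices: "\<And>y y'. y + c \<le> y' \<Longrightarrow> measure lborel {x. (x, y) \<in> S \<and> (x, y') \<in> S} \<le> s"
  shows "(measure lebesgue S)\<^sup>2 \<le> n * (s * n\<^sup>2 + 2 * c * measure lebesgue S)"
proof -
  \<comment> \<open>Extended nonnegative values let the integrals be exchanged without integrability
    conditions.\<close>
  define I :: "real \<Rightarrow> real \<Rightarrow> ennreal" where "I x y = indicator S (x, y)" for x y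
  define J :: "real \<Rightarrow> ennreal" where "J = indicator {0..n}"
  have S[measurable]: "S \<in> sets borel"
    using assms(1) by simp
  have bS: "bounded S"
    using assms(2) by (rule bounded_subset[rotated]) (intro bounded_Times bounded_closed_interval)
  have I[measurable]: "(\<lambda>(x, y). I x y) \<in> borel_measurable (lborel \<Otimes>\<^sub>M lborel)"
    unfolding I_def by (simp add: lborel_prod)
  have J[measurable]: "J \<in> borel_measurable borel"
    by (simp add: J_def)
  define m where "m = emeasure lborel S"
  define row where "row y = (\<integral>\<^sup>+x. I x y \<partial>lborel)" for y
  have m_iter: "m = (\<integral>\<^sup>+x. \<integral>\<^sup>+y. I x y \<partial>lborel \<partial>lborel)"
    using lborel.nn_integral_fst[OF I] by (simp add: m_def I_def lborel_prod)
  have row: "m = (\<integral>\<^sup>+y. row y \<partial>lborel)"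
    unfolding m_iter row_def by (intro lborel_pair.Fubini'[symmetric]) simp
  have m_fin: "m < \<infinity>"
    unfolding m_def using bS by (rule emeasure_bounded_finite)
  have m: "m = ennreal (measure lebesgue S)"
    using m_fin by (simp add: m_def emeasure_eq_ennreal_measure)
  have IJ: "I x y = I x y * J x" "I x y = I x y * J y" for x y
    using assms(2) by (auto simp: I_def J_def indicator_def)
  have int_J: "(\<integral>\<^sup>+x. J x \<partial>lborel) = ennreal n"
    using assms(5) by (simp add: J_def)
  have J_sq: "J x ^ 2 = J x" for x
    by (simp add: J_def indicator_def)
  have "m = (\<integral>\<^sup>+x. (\<integral>\<^sup>+y. I x y \<partial>lborel) * J x \<partial>lborel)"
    unfolding m_iter by (simp flip: IJ(1) nn_integral_multc)
  then have "m\<^sup>2 \<le> (\<integral>\<^sup>+x. (\<integral>\<^sup>+y. I x y \<partial>lborel)\<^sup>2 \<partial>lborel) * (\<integral>\<^sup>+x. (J x)\<^sup>2 \<partial>lborel)"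
    by (simp only:) (intro Cauchy_Schwarz_nn_integral; measurable)
  also have "(\<integral>\<^sup>+x. (J x)\<^sup>2 \<partial>lborel) = ennreal n"
    by (simp add: J_sq int_J)
  also have "(\<integral>\<^sup>+x. (\<integral>\<^sup>+y. I x y \<partial>lborel)\<^sup>2 \<partial>lborel)
      = (\<integral>\<^sup>+x. \<integral>\<^sup>+y. \<integral>\<^sup>+y'. I x y * I x y' \<partial>lborel \<partial>lborel \<partial>lborel)"
    by (simp add: nn_integral_cmult nn_integral_multc power2_eq_square)
  also have "\<dots> = (\<integral>\<^sup>+y. \<integral>\<^sup>+x. \<integral>\<^sup>+y'. I x y * I x y' \<partial>lborel \<partial>lborel \<partial>lborel)"
    by (intro lborel_pair.Fubini'[symmetric]) measurable
  also have "\<dots> = (\<integral>\<^sup>+y. \<integral>\<^sup>+y'. \<integral>\<^sup>+x. I x y * I x y' \<partial>lborel \<partial>lborel \<partial>lborel)"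
    by (intro nn_integral_cong lborel_pair.Fubini'[symmetric]) measurable
  \<comment> \<open>The first summand pays for heights at least \<open>c\<close> apart, the second
    for closer ones. The factors \<open>J\<close> keep the first summand integrable.\<close>
  also have "\<dots> \<le> (\<integral>\<^sup>+y. \<integral>\<^sup>+y'. ennreal s * J y * J y' + row y * indicator {y-c<..<y+c} y' \<partial>lborel \<partial>lborel)"
  proof (intro nn_integral_mono)
    fix y y'
    show "(\<integral>\<^sup>+x. I x y * I x y' \<partial>lborel) \<le> ennreal s * J y * J y' + row y * indicator {y-c<..<y+c} y'"
    proof (cases "\<bar>y - y'\<bar> < c")
      case True
      have "(\<integral>\<^sup>+x. I x y * I x y' \<partial>lborel) \<le> row y"
        unfolding row_def by (intro nn_integral_mono) (simp add: I_def indicator_def)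
      also have "\<dots> = row y * indicator {y-c<..<y+c} y'"
        using True by (simp add: indicator_def abs_less_iff)
      finally show ?thesis
        by (simp add: add_increasing)
    next
      case False
      define A where "A = {x. (x, y) \<in> S \<and> (x, y') \<in> S}"
      have "measure lborel A \<le> s"
        using False slices[of y y'] slices[of y' y] by (cases "y \<le> y'") (auto simp: A_def conj_commute)
      have "A = (\<lambda>x. (x, y)) -` S \<inter> (\<lambda>x. (x, y')) -` S"
        by (auto simp: A_def)
      then have "open A"
        using assms(1) by (auto intro!: open_Int open_vimage continuous_intros)
      then have [measurable]: "A \<in> sets borel" by simp
      have "bounded A"
        using bounded_fst[OF bS] by (rule bounded_subset) (force simp: A_def)
      then have "emeasure lborel A < \<infinity>"
        by (rule emeasure_bounded_finite)
      then have "emeasure lborel A \<le> ennreal s"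
        using \<open>measure lborel A \<le> s\<close> by (simp add: emeasure_eq_ennreal_measure ennreal_leI)
      have "(\<integral>\<^sup>+x. I x y * I x y' \<partial>lborel) = (\<integral>\<^sup>+x. I x y * I x y' * (J y * J y') \<partial>lborel)"
        by (subst (1 2) IJ(2)) (simp add: ac_simps J_sq flip: power2_eq_square)
      also have "\<dots> = (\<integral>\<^sup>+x. indicator A x * (J y * J y') \<partial>lborel)"
        by (intro nn_integral_cong) (auto simp: I_def A_def indicator_def)
      also have "\<dots> = emeasure lborel A * (J y * J y')"
        by (subst nn_integral_multc) simp_all
      also have "\<dots> \<le> ennreal s * (J y * J y')"
        by (intro mult_right_mono) (use \<open>emeasure lborel A \<le> ennreal s\<close> in simp_all)
      finally show ?thesis
        by (simp add: add_increasing2 mult.assoc)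
    qed
  qed
  also have "\<dots> = (\<integral>\<^sup>+y. ennreal s * ennreal n * J y + ennreal (2 * c) * row y \<partial>lborel)"
    using assms(3) by (intro nn_integral_cong, subst nn_integral_add)
      (simp_all add: nn_integral_cmult int_J mult_ac)
  also have "\<dots> = ennreal s * ennreal n * ennreal n + ennreal (2 * c) * m"
    by (subst nn_integral_add) (simp_all add: nn_integral_cmult int_J row row_def)
  finally have "m\<^sup>2 \<le> (ennreal s * ennreal n * ennreal n + ennreal (2 * c) * m) * ennreal n"
    by (simp add: mult_right_mono)
  then have "ennreal ((measure lebesgue S)\<^sup>2) \<le> ennreal ((s * n * n + 2 * c * measure lebesgue S) * n)"
    using assms(3-5) unfolding m by (simp add: ennreal_power ennreal_mult ennreal_plus)
  then show ?thesis
    using assms(3-5) by (subst (asm) ennreal_le_iff) (simp_all add: power2_eq_square mult_ac)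
qed


section \<open>Finite fields of characteristic two and quadratic codes\<close>

lemma CHAR_bit: "CHAR(bit) = 2"
  by (rule CHAR_eq_posI) (auto simp: less_Suc_eq numeral_2_eq_2)

text \<open>This realises the field with \<open>2 ^ k\<close> elements inside the algebraic closure
  of the two-element field. The polynomial \<open>X^q - X\<close> splits there, and its derivative
  is the constant -1 because \<open>q\<close> vanishes in characteristic two, so its
  \<open>q\<close> roots are distinct.\<close>

lemma card_frobenius_fixed_points:
  assumes "k > 0"
  shows "card {x :: bit alg_closure. x ^ (2 ^ k) = x} = 2 ^ k"
proof -
  define q :: nat where "q = 2 ^ k"
  have q: "q > 1"
    using assms by (simp add: q_def one_less_power del: One_nat_def)
  define p :: "bit alg_closure poly" where "p = Polynomial.monom 1 q + [:0, -1:]"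
  have deg: "Polynomial.degree p = q"
    unfolding p_def using q by (subst degree_add_eq_left) (auto simp: degree_monom_eq)
  have p0: "p \<noteq> 0" using deg q by auto
  have roots: "poly p x = 0 \<longleftrightarrow> x ^ q = x" for x
    by (simp add: p_def poly_monom)
  have char0: "(of_nat q :: bit alg_closure) = 0"
    using assms by (simp only: of_nat_eq_0_iff_char_dvd CHAR_alg_closure CHAR_bit) (simp add: q_def)
  have deriv: "poly (pderiv p) x = -1" for x
    using char0 by (simp add: p_def pderiv_add pderiv_monom pderiv_pCons poly_monom)
  obtain A u where A: "size A = Polynomial.degree p" "p = Polynomial.smult u (\<Prod>x\<in>#A. [:-x, 1:])"
    using alg_closed_imp_factorization[OF p0] by blast
  have simple: "count A a \<le> 1" for a
  proof (rule ccontr)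
    assume "\<not> count A a \<le> 1"
    then have "{#a, a#} \<subseteq># A"
      by (auto simp: subseteq_mset_def)
    then obtain B where B: "A = {#a, a#} + B"
      by (auto simp: mset_subset_eq_exists_conv)
    define r where "r = Polynomial.smult u (\<Prod>x\<in>#B. [:-x, 1:])"
    have r: "p = [:-a, 1:] * ([:-a, 1:] * r)"
      using A(2) unfolding B r_def by (simp only: image_mset_union image_mset_add_mset image_mset_empty
          prod_mset.union prod_mset.add_mset prod_mset.empty mult_1_right mult_smult_right mult.assoc)
    \<comment> \<open>By the product rule a repeated factor survives in every term of the
      derivative.\<close>
    have "poly (pderiv p) a = 0"
      unfolding r pderiv_mult by (simp only: poly_add poly_mult) simp
    with deriv show False by simp
  qed
  have "{x. poly p x = 0} = set_mset A"
  proof -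
    have "u \<noteq> 0"
      using A(2) p0 by auto
    then have "poly p x = 0 \<longleftrightarrow> x \<in># A" for x
      unfolding A(2) by (auto simp: poly_prod_mset prod_mset_zero_iff)
    then show ?thesis by blast
  qed
  moreover have "card (set_mset A) = size A"
  proof -
    have "count A x = 1" if "x \<in># A" for x
      using simple[of x] that by (metis One_nat_def Suc_leI count_greater_zero_iff le_antisym)
    then show ?thesis
      by (simp add: size_multiset_overloaded_eq)
  qed
  ultimately show ?thesis
    using A(1) deg roots by (simp add: q_def)
qed

text \<open>The difference is a nonzero polynomial of degree at most two. Finiteness is recorded
  separately because \<open>card\<close> is 0 on infinite sets, so the bound alone does not pass to
  subsets.\<close>

lemma card_quadratic_agreement:
  fixes a b c :: "'a :: field"
  assumes "(a, b, c) \<noteq> (a', b', c')"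
  shows "finite {x. a + b * x + c * x\<^sup>2 = a' + b' * x + c' * x\<^sup>2}"
    and "card {x. a + b * x + c * x\<^sup>2 = a' + b' * x + c' * x\<^sup>2} \<le> 2"
proof -
  define p where "p = [:a - a', b - b', c - c':]"
  have p0: "p \<noteq> 0"
    using assms by (auto simp: p_def)
  have eq: "{x. a + b * x + c * x\<^sup>2 = a' + b' * x + c' * x\<^sup>2} = {x. poly p x = 0}"
    by (auto simp: p_def algebra_simps power2_eq_square)
  have "Polynomial.degree p \<le> 2"
    by (simp add: p_def)
  then show "finite {x. a + b * x + c * x\<^sup>2 = a' + b' * x + c' * x\<^sup>2}"
    and "card {x. a + b * x + c * x\<^sup>2 = a' + b' * x + c' * x\<^sup>2} \<le> 2"
    unfolding eq using poly_roots_finite[OF p0] card_poly_roots_bound[OF p0] by auto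
qed

text \<open>Indices \<open>r\<close> enumerate coefficient triples over the field \<open>K\<close>
  and indices \<open>a\<close> enumerate its elements; \<open>g r a\<close> is the number of the
  value of quadratic \<open>r\<close> at element \<open>a\<close>.\<close>

lemma quadratic_code_exists:
  assumes "k > 0" and q: "q = 2 ^ k"
  obtains g :: "nat \<Rightarrow> nat \<Rightarrow> nat"
    where "\<And>r a. r < q ^ 3 \<Longrightarrow> a < q \<Longrightarrow> g r a < q"
      and "\<And>r r'. r < q ^ 3 \<Longrightarrow> r' < q ^ 3 \<Longrightarrow> r \<noteq> r' \<Longrightarrow> card {a. a < q \<and> g r a = g r' a} \<le> 2"
proof -
  define K where "K = {x :: bit alg_closure. x ^ q = x}"
  have card_K: "card K = q"
    using card_frobenius_fixed_points[OF assms(1)] by (simp add: K_def q)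
  have fin: "finite K"
    using card_K q by (metis card.infinite power_not_zero zero_neq_numeral)
  \<comment> \<open>Raising to the power \<open>q\<close> is additive, since \<open>q\<close> is a
    power of the characteristic.\<close>
  have add: "x + y \<in> K" if "x \<in> K" "y \<in> K" for x y
    using that freshmans_dream'[of q k x y] by (simp add: K_def q CHAR_bit)
  have mult: "x * y \<in> K" if "x \<in> K" "y \<in> K" for x y
    using that by (simp add: K_def power_mult_distrib)
  obtain e where e: "bij_betw e {..<q} K"
    using fin card_K by (metis atLeast0LessThan ex_bij_betw_nat_finite)
  have "card (K \<times> K \<times> K) = q ^ 3"
    by (simp add: card_cartesian_product card_K power3_eq_cube)
  then obtain t where t: "bij_betw t {..<q ^ 3} (K \<times> K \<times> K)"
    using fin by (metis atLeast0LessThan ex_bij_betw_nat_finite finite_cartesian_product)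
  define Q where "Q = (\<lambda>(u, v, w) x. u + v * x + w * x\<^sup>2 :: bit alg_closure)"
  define d where "d = the_inv_into {..<q} e"
  have d: "bij_betw d K {..<q}"
    unfolding d_def by (rule bij_betw_the_inv_into[OF e])
  have Q_in: "Q (t r) (e a) \<in> K" if "r < q ^ 3" "a < q" for r a
  proof -
    have "t r \<in> K \<times> K \<times> K" "e a \<in> K"
      using that bij_betwE[OF t] bij_betwE[OF e] by auto
    then show ?thesis
      by (auto simp: Q_def power2_eq_square intro!: add mult)
  qed
  show ?thesis
  proof
    fix r a assume "r < q ^ 3" "a < q"
    then show "d (Q (t r) (e a)) < q"
      using bij_betwE[OF d] Q_in by auto
  next
    fix r r' assume r: "r < q ^ 3" "r' < q ^ 3" "r \<noteq> r'"
    obtain u v w where tr: "t r = (u, v, w)" by (metis prod_cases3)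
    obtain u' v' w' where tr': "t r' = (u', v', w')" by (metis prod_cases3)
    have ne: "(u, v, w) \<noteq> (u', v', w')"
      using r t by (metis tr tr' bij_betw_def inj_on_def lessThan_iff)
    let ?Z = "{x. u + v * x + w * x\<^sup>2 = u' + v' * x + w' * x\<^sup>2}"
    let ?X = "{a. a < q \<and> d (Q (t r) (e a)) = d (Q (t r') (e a))}"
    have "e ` ?X \<subseteq> ?Z"
    proof clarify
      fix a assume a: "a < q" "d (Q (t r) (e a)) = d (Q (t r') (e a))"
      then have "Q (t r) (e a) = Q (t r') (e a)"
        using d Q_in r by (meson bij_betw_def inj_onD)
      then show "u + v * e a + w * (e a)\<^sup>2 = u' + v' * e a + w' * (e a)\<^sup>2"
        by (simp add: Q_def tr tr')
    qed
    moreover have "inj_on e ?X"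
      using e by (auto simp: bij_betw_def intro: inj_on_subset)
    ultimately have "card ?X \<le> card ?Z"
      using card_quadratic_agreement(1)[OF ne] by (meson card_inj_on_le)
    also have "\<dots> \<le> 2"
      by (rule card_quadratic_agreement(2)[OF ne])
    finally show "card ?X \<le> 2" .
  qed
qed


section \<open>The set built from a code\<close>

text \<open>Open intervals make unions of boxes open and leave out only grid lines, which have
  measure zero. Two points of one cell differ by strictly less than \<open>w\<close>.\<close>

definition cell :: "real \<Rightarrow> nat \<Rightarrow> real set" where
  "cell w j = {real j * w <..< (real j + 1) * w}"

lemma cell_inj:
  assumes "x \<in> cell w i" "x \<in> cell w j" "0 < w"
  shows "i = j"
proof -
  have "\<lfloor>x / w\<rfloor> = int k" if "x \<in> cell w k" for k
    using that assms(3) by (intro floor_unique) (auto simp: cell_def field_simps)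
  then show ?thesis
    using assms by (metis of_nat_eq_iff)
qed

lemma open_cell: "open (cell w j)"
  by (simp add: cell_def)

lemma emeasure_cell_Times:
  assumes "0 < w" "0 < h"
  shows "emeasure lborel (cell w i \<times> cell h j) = ennreal (w * h)"
proof -
  have "emeasure lborel (cell w i \<times> cell h j) = emeasure lborel (cell w i) * emeasure lborel (cell h j)"
    by (subst lborel_prod[symmetric], subst lborel.emeasure_pair_measure_Times) (auto simp: cell_def)
  also have "\<dots> = ennreal (w * h)"
    using assms by (simp add: cell_def algebra_simps ennreal_mult)
  finally show ?thesis .
qed

text \<open>The columns form \<open>q\<close> blocks of \<open>q\<close>; the pair (block
  \<open>a\<close>, position \<open>u\<close>) is column \<open>a * q + u\<close>. Row
  \<open>r\<close> takes one column from each block, at position \<open>g r a\<close>.\<close>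

definition code_set :: "nat \<Rightarrow> (nat \<Rightarrow> nat \<Rightarrow> nat) \<Rightarrow> nat \<Rightarrow> real \<Rightarrow> real \<Rightarrow> (real \<times> real) set" where
  "code_set q g N w h = (\<Union>(r, a)\<in>{..<N} \<times> {..<q}. cell w (a * q + g r a) \<times> cell h r)"

lemma open_code_set: "open (code_set q g N w h)"
  by (auto simp: code_set_def cell_def intro!: open_UN open_Times)

lemma code_index_inj:
  fixes a b q u v :: nat
  assumes "a * q + u = b * q + v" "u < q" "v < q"
  shows "a = b \<and> u = v"
proof -
  have "a = (a * q + u) div q" "b = (b * q + v) div q"
    using assms(2,3) gr_implies_not0 by (auto simp: div_mult_self3)
  with assms(1) show ?thesis by simp
qed

lemma cell_subset:
  assumes "real (Suc j) * w \<le> n" "0 < w"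
  shows "cell w j \<subseteq> {0..n}"
proof
  fix x assume "x \<in> cell w j"
  moreover have "0 \<le> real j * w" "(real j + 1) * w \<le> n"
    using assms by (simp_all add: add.commute)
  ultimately show "x \<in> {0..n}"
    by (simp add: cell_def)
qed

lemma code_set_subset:
  assumes "\<And>r a. r < N \<Longrightarrow> a < q \<Longrightarrow> g r a < q"
    and "real (q\<^sup>2) * w \<le> n" "real N * h \<le> n" "0 < w" "0 < h"
  shows "code_set q g N w h \<subseteq> {0..n} \<times> {0..n}"
proof -
  have "cell w (a * q + g r a) \<times> cell h r \<subseteq> {0..n} \<times> {0..n}" if ra: "r < N" "a < q" for r a
  proof (intro Sigma_mono cell_subset assms(4,5))
    have "Suc (a * q + g r a) \<le> Suc a * q"
      using assms(1)[OF ra] by simp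
    also have "\<dots> \<le> q\<^sup>2"
      unfolding power2_eq_square using ra by (intro mult_right_mono) auto
    finally have "real (Suc (a * q + g r a)) * w \<le> real (q\<^sup>2) * w"
      using assms(4) by (intro mult_right_mono) (simp_all only: of_nat_le_iff less_imp_le)
    then show "real (Suc (a * q + g r a)) * w \<le> n"
      using assms(2) by linarith
    have "real (Suc r) * h \<le> real N * h"
      using ra assms(5) by (intro mult_right_mono) auto
    then show "real (Suc r) * h \<le> n"
      using assms(3) by linarith
  qed
  then show ?thesis
    unfolding code_set_def by (intro UN_least) auto
qed

text \<open>The boxes are disjoint: different rows do not meet, and within a row different blocks
  give different columns because \<open>g r a < q\<close>.\<close>

lemma measure_code_set:
  assumes "\<And>r a. r < N \<Longrightarrow> a < q \<Longrightarrow> g r a < q" "0 < w" "0 < h"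
  shows "measure lebesgue (code_set q g N w h) = real N * real q * (w * h)"
proof -
  let ?B = "\<lambda>(r, a). cell w (a * q + g r a) \<times> cell h r"
  have B: "measure lborel (?B p) = w * h" "emeasure lborel (?B p) \<noteq> \<infinity>" "?B p \<in> sets lborel" for p
    using assms(2,3) emeasure_cell_Times[OF assms(2,3)]
    by (auto simp: measure_def split: prod.splits intro!: borel_open open_Times open_cell)
  have "disjoint_family_on ?B ({..<N} \<times> {..<q})"
  proof (clarsimp simp: disjoint_family_on_def)
    fix r a r' a'
    assume *: "r < N" "a < q" "r' < N" "a' < q" "r = r' \<longrightarrow> a \<noteq> a'"
    show "cell w (a * q + g r a) \<times> cell h r \<inter> cell w (a' * q + g r' a') \<times> cell h r' = {}"
    proof (rule ccontr)
      assume "\<not> ?thesis"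
      then obtain x y where "x \<in> cell w (a * q + g r a)" "x \<in> cell w (a' * q + g r' a')"
          "y \<in> cell h r" "y \<in> cell h r'"
        by blast
      then have "r = r'" "a * q + g r a = a' * q + g r' a'"
        using cell_inj[OF _ _ assms(2)] cell_inj[OF _ _ assms(3)] by simp_all
      with * assms(1) show False
        using code_index_inj[of a q "g r a" a' "g r' a'"] by simp
    qed
  qed
  then have "measure lborel (\<Union>p\<in>{..<N} \<times> {..<q}. ?B p) = (\<Sum>p\<in>{..<N} \<times> {..<q}. measure lborel (?B p))"
    using B by (intro measure_finite_Union) auto
  also have "\<dots> = real N * real q * (w * h)"
    by (simp add: B(1))
  finally show ?thesis
    using open_code_set[of q g N w h] by (simp add: code_set_def)
qed

text \<open>A copy of the pattern would occupy two different rows, and each \<open>f x\<close> would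
  lie in a column common to both. There are at most two such columns, each too narrow for two points
  at distance \<open>s / 2\<close>.\<close>

lemma code_set_pattern_free:
  assumes g: "\<And>r a. r < N \<Longrightarrow> a < q \<Longrightarrow> g r a < q"
    and agree: "\<And>r r'. r < N \<Longrightarrow> r' < N \<Longrightarrow> r \<noteq> r' \<Longrightarrow> card {a. a < q \<and> g r a = g r' a} \<le> 2"
    and "0 < s" "0 < c"
  shows "pattern_free (two_segments s c) (code_set q g N (s / 2) c)"
proof
  let ?S = "code_set q g N (s / 2) c"
  have fst_P: "fst ` two_segments s c = {0..s}" and snd_P: "snd ` two_segments s c = {c, 2 * c}"
    using assms(3) by (simp_all add: fst_two_segments snd_two_segments)
  assume "contains_pattern ?S (two_segments s c)"
  then obtain f h where f: "expanding_on {0..s} f" and h: "expanding_on {c, 2 * c} h"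
      and "\<forall>(x, y)\<in>two_segments s c. (f x, h y) \<in> ?S"
    unfolding contains_pattern_def fst_P snd_P by blast
  then have S: "(f x, h c) \<in> ?S" "(f x, h (2 * c)) \<in> ?S" if "x \<in> {0..s}" for x
    using that by (auto simp: two_segments_def)
  have "h (2 * c) - h c \<ge> c"
    using h assms(4) by (auto simp: expanding_on_def)
  have "0 \<in> {0..s}" using assms(3) by simp
  from S[OF this] obtain r r' where r: "r < N" "h c \<in> cell c r" "r' < N" "h (2 * c) \<in> cell c r'"
    unfolding code_set_def by auto
  \<comment> \<open>Two points of one open cell of height \<open>c\<close> differ by less than
    \<open>c\<close>.\<close>
  have "r \<noteq> r'"
    using r \<open>h (2 * c) - h c \<ge> c\<close> by (auto simp: cell_def algebra_simps)
  define Z where "Z = {a. a < q \<and> g r a = g r' a}"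
  have col: "\<exists>a\<in>Z. f x \<in> cell (s / 2) (a * q + g r a)" if x: "x \<in> {0..s}" for x
  proof -
    obtain t a where ta: "t < N" "a < q" "f x \<in> cell (s / 2) (a * q + g t a)" "h c \<in> cell c t"
      using S(1)[OF x] unfolding code_set_def by auto
    obtain t' a' where ta': "t' < N" "a' < q" "f x \<in> cell (s / 2) (a' * q + g t' a')" "h (2 * c) \<in> cell c t'"
      using S(2)[OF x] unfolding code_set_def by auto
    have "t = r" "t' = r'"
      using cell_inj[OF ta(4) r(2) assms(4)] cell_inj[OF ta'(4) r(4) assms(4)] by simp_all
    moreover have "a * q + g t a = a' * q + g t' a'"
      using cell_inj[OF ta(3) ta'(3)] assms(3) by simp
    ultimately have "a = a'" "g r a = g r' a'"
      using code_index_inj[of a q "g r a" a' "g r' a'"] ta ta' g by simp_all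
    with ta \<open>t = r\<close> show ?thesis
      unfolding Z_def by auto
  qed
  then obtain k where k: "\<And>x. x \<in> {0..s} \<Longrightarrow> k x \<in> Z \<and> f x \<in> cell (s / 2) (k x * q + g r (k x))"
    by metis
  \<comment> \<open>Three points with gaps at least \<open>s / 2\<close>: one more than the number
    of common columns.\<close>
  let ?X = "{0, s / 2, s}"
  have "card (k ` ?X) \<le> card Z"
    using k assms(3) by (intro card_mono) (auto simp: Z_def)
  also have "\<dots> \<le> 2"
    unfolding Z_def using r \<open>r \<noteq> r'\<close> by (intro agree)
  also have "\<dots> < card ?X"
    using assms(3) by simp
  finally have "\<not> inj_on k ?X"
    by (metis card_image less_irrefl)
  then obtain x y where xy: "x \<in> ?X" "y \<in> ?X" "x < y" "k x = k y"
    using linorder_inj_onI'[of ?X k] by blast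
  then have range: "x \<in> {0..s}" "y \<in> {0..s}" and gap: "y - x \<ge> s / 2"
    using assms(3) by auto
  have "1 \<le> (f y - f x) / (y - x)"
    using f xy(3) range unfolding expanding_on_def by blast
  then have "y - x \<le> f y - f x"
    using xy(3) by (simp only: pos_le_divide_eq diff_gt_0_iff_gt mult_1)
  with gap have "f y - f x \<ge> s / 2"
    by linarith
  moreover have "f y - f x < s / 2"
    using k[OF range(1)] k[OF range(2)] unfolding xy(4) by (auto simp: cell_def algebra_simps)
  ultimately show False by simp
qed

section \<open>Explicit bounds for large \<open>n\<close>\<close>

text \<open>With \<open>b = sqrt (s * n ^ 3)\<close>, the condition
  \<open>4 * c\<^sup>2 \<le> s * n\<close> says exactly that \<open>2 * c * n \<le> b\<close>. The
  slice bound then becomes \<open>m\<^sup>2 \<le> b\<^sup>2 + b * m\<close>, which fails for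
  \<open>m > 2 * b\<close>.\<close>

lemma measure_pattern_free_le:
  assumes "open S" "S \<subseteq> {0..n} \<times> {0..n}" "pattern_free (two_segments s c) S"
    and "0 < s" "0 < c" "0 < n" "4 * c\<^sup>2 \<le> s * n"
  shows "measure lebesgue S \<le> 2 * sqrt (s * n ^ 3)"
proof (rule ccontr)
  define m where "m = measure lebesgue S"
  define b where "b = sqrt (s * n ^ 3)"
  have b: "0 < b" "b\<^sup>2 = s * n ^ 3"
    using assms by (simp_all add: b_def)
  assume "\<not> ?thesis"
  then have m: "2 * b < m"
    by (simp add: m_def b_def)
  have "bounded S"
    using assms(2) by (rule bounded_subset[rotated]) (intro bounded_Times bounded_closed_interval)
  then have "m\<^sup>2 \<le> n * (s * n\<^sup>2 + 2 * c * m)"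
    unfolding m_def using assms by (intro measure_le_of_slices pattern_free_slices) auto
  also have "\<dots> = b\<^sup>2 + 2 * c * n * m"
    unfolding b by (simp add: algebra_simps power2_eq_square power3_eq_cube)
  finally have "m\<^sup>2 \<le> b\<^sup>2 + 2 * c * n * m" .
  moreover have "2 * c * n \<le> b"
  proof (rule power2_le_imp_le)
    have "(2 * c * n)\<^sup>2 = 4 * c\<^sup>2 * n\<^sup>2"
      by (simp add: power_mult_distrib)
    also have "\<dots> \<le> s * n * n\<^sup>2"
      using assms by (intro mult_right_mono) auto
    finally show "(2 * c * n)\<^sup>2 \<le> b\<^sup>2"
      unfolding b by (simp add: power2_eq_square power3_eq_cube)
  qed (use b in simp)
  then have "2 * c * n * m \<le> b * m"
    using m b by (intro mult_right_mono) auto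
  moreover have "2 * b * m < m * m" "b * (2 * b) < b * m"
    using m b by (auto intro: mult_strict_right_mono mult_strict_left_mono)
  moreover have "0 < b * b"
    using b by simp
  ultimately show False
    by (simp add: power2_eq_square)
qed

text \<open>About \<open>2 * n / s\<close> columns of width \<open>s / 2\<close> fit. Taking
  \<open>q\<^sup>2\<close> as the largest power of four within that number costs only a constant
  factor. The bounds \<open>2 * s \<le> n\<close> and \<open>2 * c \<le> n\<close> give
  \<open>k > 0\<close> and rows filling at least half the height; the last hypothesis ensures that
  there are enough quadratics for all rows.\<close>

lemma large_pattern_free_exists:
  assumes "0 < s" "0 < c" "2 * s \<le> n" "2 * c \<le> n" "8 * s ^ 3 \<le> c\<^sup>2 * n"
  obtains S where "open S" "S \<subseteq> {0..n} \<times> {0..n}" "pattern_free (two_segments s c) S"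
    "1 / 6 * sqrt (s * n ^ 3) \<le> measure lebesgue S"
proof -
  have n: "0 < n" using assms by simp
  define z where "z = nat \<lfloor>2 * n / s\<rfloor>"
  have z: "real z \<le> 2 * n / s" "2 * n / s < real z + 1"
    using n assms(1) by (simp_all add: z_def)
  have "4 \<le> 2 * n / s"
    using assms by (simp add: field_simps)
  then have "4 \<le> z"
    using z by linarith
  then obtain k where k: "4 ^ k \<le> z" "z < 4 ^ (k + 1)"
    using ex_power_ivl1[of 4 z] by auto
  then have "k > 0"
    using \<open>4 \<le> z\<close> by (cases k) auto
  define q :: nat where "q = 2 ^ k"
  have q_sq: "q\<^sup>2 = 4 ^ k"
    by (simp add: q_def power2_eq_square flip: power_mult_distrib)
  \<comment> \<open>The successor absorbs the rounding in \<open>z\<close>: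
    \<open>2 * n / s < z + 1\<close>, which is at most \<open>4 * q\<^sup>2\<close>.\<close>
  have "4 ^ k \<le> z" "Suc z \<le> 4 * 4 ^ k"
    using k by simp_all
  then have "real (4 ^ k) \<le> real z" "real (Suc z) \<le> real (4 * 4 ^ k)"
    by (simp_all only: of_nat_le_iff)
  then have "real (q\<^sup>2) \<le> 2 * n / s" "2 * n / s < 4 * real (q\<^sup>2)"
    using z unfolding q_sq of_nat_Suc of_nat_mult by linarith+
  then have q_le: "real (q\<^sup>2) * (s / 2) \<le> n" and q_gt: "n < 2 * s * (real q)\<^sup>2"
    using assms(1) by (simp_all add: field_simps)
  define N where "N = nat \<lfloor>n / c\<rfloor>"
  have "real N \<le> n / c" "n / c < real N + 1"
    using n assms(2) by (simp_all add: N_def)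
  then have N_le: "real N * c \<le> n" and "n < real N * c + c"
    using assms(2) by (simp_all add: field_simps)
  then have N_ge: "n / 2 \<le> real N * c"
    using assms(4) by simp
  \<comment> \<open>From \<open>q\<^sup>2 > n / (2 * s)\<close>, the sixth power of \<open>q\<close>
    exceeds \<open>n ^ 3 / (8 * s ^ 3)\<close>, which is at least
    \<open>(n / c)\<^sup>2\<close>.\<close>
  have "N \<le> q ^ 3"
  proof -
    have "(n / c)\<^sup>2 \<le> (real q ^ 3)\<^sup>2"
    proof -
      have "8 * s ^ 3 * n\<^sup>2 \<le> c\<^sup>2 * n * n\<^sup>2"
        using assms(5) by (intro mult_right_mono) auto
      also have "\<dots> = c\<^sup>2 * n ^ 3"
        by (simp add: power2_eq_square power3_eq_cube)
      also have "\<dots> \<le> c\<^sup>2 * (2 * s * (real q)\<^sup>2) ^ 3"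
        using q_gt n by (intro mult_left_mono power_mono) auto
      also have "\<dots> = 8 * s ^ 3 * (c\<^sup>2 * (real q ^ 3)\<^sup>2)"
        by (simp add: power_mult_distrib flip: power_mult)
      finally have "n\<^sup>2 \<le> c\<^sup>2 * (real q ^ 3)\<^sup>2"
        using assms(1) by simp
      then show ?thesis
        using assms(2) by (simp add: power_divide field_simps)
    qed
    then have "n / c \<le> real (q ^ 3)"
      using power2_le_imp_le[of "n / c" "real q ^ 3"] by simp
    then show ?thesis
      using \<open>real N \<le> n / c\<close> by (meson of_nat_le_iff order_trans)
  qed
  then have less: "r < q ^ 3" if "r < N" for r
    using that by simp
  obtain g where "\<And>r a. r < q ^ 3 \<Longrightarrow> a < q \<Longrightarrow> g r a < q"
      "\<And>r r'. r < q ^ 3 \<Longrightarrow> r' < q ^ 3 \<Longrightarrow> r \<noteq> r' \<Longrightarrow> card {a. a < q \<and> g r a = g r' a} \<le> 2"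
    using quadratic_code_exists[OF \<open>k > 0\<close> q_def] by blast
  then have g: "\<And>r a. r < N \<Longrightarrow> a < q \<Longrightarrow> g r a < q"
      "\<And>r r'. r < N \<Longrightarrow> r' < N \<Longrightarrow> r \<noteq> r' \<Longrightarrow> card {a. a < q \<and> g r a = g r' a} \<le> 2"
    using less by simp_all
  let ?S = "code_set q g N (s / 2) c"
  have "measure lebesgue ?S = real N * real q * (s / 2 * c)"
    using assms(1,2) by (intro measure_code_set g(1)) simp_all
  also have "\<dots> = real N * c * (real q * s / 2)"
    by simp
  also have "n / 2 * (real q * s / 2) \<le> \<dots>"
    using N_ge assms(1) by (intro mult_right_mono) auto
  finally have meas: "n * real q * s / 4 \<le> measure lebesgue ?S"
    by simp
  \<comment> \<open>Squaring the bound \<open>n * q * s / 4\<close> and using \<open>q_gt\<close>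
    gives the factor 1/32; weakening it to 1/36 yields the rational constant 1/6.\<close>
  have "(1 / 6 * sqrt (s * n ^ 3))\<^sup>2 = s * n\<^sup>2 * n / 36"
    using n assms(1) by (simp add: power_mult_distrib power2_eq_square power3_eq_cube)
  also have "\<dots> \<le> s * n\<^sup>2 * (2 * s * (real q)\<^sup>2) / 32"
    using q_gt n assms(1) by (intro frac_le mult_left_mono) auto
  also have "\<dots> = (n * real q * s / 4)\<^sup>2"
    by (simp add: power_divide power_mult_distrib power2_eq_square)
  finally have "1 / 6 * sqrt (s * n ^ 3) \<le> n * real q * s / 4"
    by (rule power2_le_imp_le) (use n assms(1) in simp)
  with meas have big: "1 / 6 * sqrt (s * n ^ 3) \<le> measure lebesgue ?S"
    by linarith
  show ?thesis
  proof
    show "?S \<subseteq> {0..n} \<times> {0..n}"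
      using q_le N_le assms(1,2) by (intro code_set_subset g(1)) simp_all
    show "pattern_free (two_segments s c) ?S"
      using assms(1,2) by (intro code_set_pattern_free g) simp_all
  qed (fact open_code_set big)+
qed

theorem theorem4p6:
  fixes c :: real
  assumes "c > 0"
  shows "\<exists>C1 > 0. \<exists>C2 > 0. \<forall>s > 0. \<forall>\<^sub>F n in at_top.
           C1 * (s powr (1/2) * n powr (3/2)) \<le> opx n (two_segments s c) \<and>
           opx n (two_segments s c) \<le> C2 * (s powr (1/2) * n powr (3/2))"
proof -
  \<comment> \<open>The constants 1/6 and 2 are absolute; \<open>s\<close> and \<open>c\<close>
    enter only through the five thresholds on \<open>n\<close>.\<close>
  have bounds: "1 / 6 * (s powr (1/2) * n powr (3/2)) \<le> opx n (two_segments s c) \<and>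
      opx n (two_segments s c) \<le> 2 * (s powr (1/2) * n powr (3/2))"
    if s: "0 < s" and n: "0 < n" "4 * c\<^sup>2 / s \<le> n" "2 * s \<le> n" "2 * c \<le> n" "8 * s ^ 3 / c\<^sup>2 \<le> n" for s n
  proof -
    define \<S> where "\<S> = {S. open S \<and> S \<subseteq> {0..n} \<times> {0..n} \<and> pattern_free (two_segments s c) S}"
    have opx: "opx n (two_segments s c) = (SUP S\<in>\<S>. measure lebesgue S)"
      unfolding opx_def \<S>_def setcompr_eq_image ..
    have "n powr (3/2) = (n powr 3) powr (1/2)"
      by (simp add: powr_powr)
    also have "n powr 3 = n ^ 3"
      using n by (simp add: powr_numeral)
    finally have X: "s powr (1/2) * n powr (3/2) = sqrt (s * n ^ 3)"
      using n s by (simp add: powr_half_sqrt real_sqrt_mult)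
    have large: "4 * c\<^sup>2 \<le> s * n" "8 * s ^ 3 \<le> c\<^sup>2 * n"
      using n s assms by (simp_all add: pos_divide_le_eq mult.commute)
    have upper: "measure lebesgue S \<le> 2 * sqrt (s * n ^ 3)" if "S \<in> \<S>" for S
      using that s n(1) assms large(1) by (intro measure_pattern_free_le) (simp_all add: \<S>_def)
    obtain S where S: "S \<in> \<S>" "1 / 6 * sqrt (s * n ^ 3) \<le> measure lebesgue S"
      using large_pattern_free_exists[OF s assms n(3,4) large(2)] unfolding \<S>_def by blast
    \<comment> \<open>The uniform bound \<open>upper\<close> also supplies the boundedness that a
      real supremum requires.\<close>
    have "1 / 6 * sqrt (s * n ^ 3) \<le> (SUP S\<in>\<S>. measure lebesgue S)"
      using S upper by (intro cSUP_upper2[of _ _ S]) (auto intro!: bdd_aboveI2)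
    moreover have "(SUP S\<in>\<S>. measure lebesgue S) \<le> 2 * sqrt (s * n ^ 3)"
      using S upper by (intro cSUP_least) auto
    ultimately show ?thesis
      unfolding opx X by simp
  qed
  have "\<forall>\<^sub>F n in at_top. 1 / 6 * (s powr (1/2) * n powr (3/2)) \<le> opx n (two_segments s c) \<and>
      opx n (two_segments s c) \<le> 2 * (s powr (1/2) * n powr (3/2))" if "0 < s" for s
    using eventually_gt_at_top[of 0] eventually_ge_at_top[of "4 * c\<^sup>2 / s"]
      eventually_ge_at_top[of "2 * s"] eventually_ge_at_top[of "2 * c"]
      eventually_ge_at_top[of "8 * s ^ 3 / c\<^sup>2"]
    by eventually_elim (rule bounds[OF that])
  moreover have "(0::real) < 1 / 6" "(0::real) < 2"
    by simp_all
  ultimately show ?thesis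
    by blast
qed

end
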